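(* Let $\Gamma\in\mathbb{R}$ be a cutoff parameter and let $\Delta_0\ge 1$ be an integer. Let $$\mathcal{I}=\{(G_1,G_2): G_1\ge G_2,\ \|G_1-G_2\|_{\ell_1}\le 1\},$$ where $G_1,G_2$ range over weighted histograms. Then the $\ell_1$-descent update policy $\phi$ (with $\ell_1$ budget $1$ and cutoff $\Gamma$) is $\ell_1$-contractive over the invariant subset $\mathcal{I}$.
   Context: $U$ is a set of items. A weighted histogram is any map $H:U\to\mathbb{R}$. For histograms, $G_1\ge G_2$ means $G_1[u]\ge G_2[u]$ for every item $u$. Sets $W$ range over subsets of $U$ of size at most $\Delta_0$. The $\ell_1$-descent update policy maps a histogram $H_0$ and a set $W$ to the histogram $H_1=\phi(H_0,W)$ defined as follows. $H_1[u]=H_0[u]$ for $u\notin W$. Put $G[u]=\Gamma-H_0[u]$ for $u\in W$. If $\|G\|_{\ell_1}=\sum_{u\in W}|G[u]|\le 1$, then $H_1[u]=\Gamma$ for all $u\in W$. Otherwise, find $\lambda\ge 0$ such that $\sum_{u\in W}\min\{G[u],\lambda\}=1$ and set $H_1[u]=H_0[u]+\min\{G[u],\lambda\}$ for all $u\in W$. $\phi$ is $\ell_1$-contractive over the invariant subset $\mathcal{I}$ (a set of pairs of weighted histograms at $\ell_1$-distance at most $1$) if: (1) $(H_1,H_2)\in\mathcal{I}$ implies $(\phi(H_1,W),\phi(H_2,W))\in\mathcal{I}$ for all $W$; (2) $(\phi(H,W),H)\in\mathcal{I}$ for all weighted histograms $H$ and all $W$.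
   Formalization: Condition (2) is claimed only for H with H[u] ≤ Γ on W (it fails, or φ is undefined, if H[u] > Γ for some u in W, e.g. H[u] = Γ+1/2, W = {u}); condition (1) is claimed whenever both updates are defined, i.e. a suitable λ exists. *)

theory Defs
  imports "HOL-Analysis.Analysis"
begin

type_synonym 'u hist = "'u \<Rightarrow> real"

(* Takes the value infinity on functions that are not absolutely summable (the type of items may
   be infinite). *)
definition l1_norm :: "('u \<Rightarrow> real) \<Rightarrow> ennreal" where
  "l1_norm f = (\<Sum>\<^sub>\<infinity>u. ennreal \<bar>f u\<bar>)"

(* None: no lambda as required exists. This happens only if H0 exceeds Gamma somewhere on W, so
   that G has negative entries. If lambda exists it need not be unique, but the resulting
   histogram does not depend on the choice. *)
definition l1_descent :: "real \<Rightarrow> 'u hist \<Rightarrow> 'u set \<Rightarrow> 'u hist option" where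
  "l1_descent \<Gamma> H0 W =
     (let G = (\<lambda>u. \<Gamma> - H0 u);
          good = (\<lambda>l. l \<ge> 0 \<and> (\<Sum>u\<in>W. min (G u) l) = 1)
      in if (\<Sum>u\<in>W. \<bar>G u\<bar>) \<le> 1 then Some (\<lambda>u. if u \<in> W then \<Gamma> else H0 u)
         else if \<exists>l. good l
              then Some (\<lambda>u. if u \<in> W then H0 u + min (G u) (SOME l. good l) else H0 u)
         else None)"

definition below_cutoff :: "real \<Rightarrow> ('u hist \<times> 'u set) set" where
  "below_cutoff \<Gamma> = {(H, W). \<forall>u\<in>W. H u \<le> \<Gamma>}"

(* Contractivity of a partial update policy phi over the invariant subset I. Invariance of I is
   required wherever phi is defined. On the inputs in D, phi has to be defined and the update has
   to satisfy (phi(H,W), H) \<in> I. The set D is needed for l1_descent: if H exceeds Gamma at some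
   item of W, the update either does not exist or decreases H there to Gamma, so that it is not
   above H. *)
definition l1_contractive_over ::
  "nat \<Rightarrow> ('u hist \<times> 'u set) set \<Rightarrow> ('u hist \<Rightarrow> 'u set \<Rightarrow> 'u hist option)
     \<Rightarrow> ('u hist \<times> 'u hist) set \<Rightarrow> bool" where
  "l1_contractive_over \<Delta>0 D \<phi> I \<longleftrightarrow>
     (\<forall>(G1, G2) \<in> I. l1_norm (\<lambda>u. G1 u - G2 u) \<le> 1) \<and>
     (\<forall>W. finite W \<and> card W \<le> \<Delta>0 \<longrightarrow>
        (\<forall>H1 H2 H1' H2'. (H1, H2) \<in> I \<and> \<phi> H1 W = Some H1' \<and> \<phi> H2 W = Some H2'
            \<longrightarrow> (H1', H2') \<in> I) \<and>
        (\<forall>H. (H, W) \<in> D \<longrightarrow> (\<exists>H'. \<phi> H W = Some H' \<and> (H', H) \<in> I)))"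

definition dominating_pairs :: "('u hist \<times> 'u hist) set" where
  "dominating_pairs = {(G1, G2). G1 \<ge> G2 \<and> l1_norm (\<lambda>u. G1 u - G2 u) \<le> 1}"

end

theory Submission
  imports Defs
begin

text \<open>
  On \<open>W\<close> the update is \<open>H' = min \<Gamma> (H + l)\<close>, and a larger histogram needs a larger level \<open>l\<close> to
  spend the same budget, so the update is monotone. For a dominating pair the distance
  is the plain sum of the differences, and the dominated histogram receives at least as much
  mass on \<open>W\<close> as the dominating one unless both end up constantly \<open>\<Gamma>\<close> there; hence the distance
  does not grow.
\<close>

lemma l1_norm_split:
  assumes "finite W"
  shows "l1_norm f = (\<Sum>u\<in>W. ennreal \<bar>f u\<bar>) + (\<Sum>\<^sub>\<infinity>u\<in>-W. ennreal \<bar>f u\<bar>)"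
proof -
  have "l1_norm f = (\<Sum>\<^sub>\<infinity>u\<in>W \<union> -W. ennreal \<bar>f u\<bar>)"
    by (simp add: l1_norm_def)
  also have "\<dots> = (\<Sum>\<^sub>\<infinity>u\<in>W. ennreal \<bar>f u\<bar>) + (\<Sum>\<^sub>\<infinity>u\<in>-W. ennreal \<bar>f u\<bar>)"
    by (intro infsum_Un_disjoint nonneg_summable_on_complete) auto
  finally show ?thesis
    using assms by simp
qed

text \<open>An update touches only the finite set \<open>W\<close>, so the tail outside
  \<open>W\<close> is common to both norms, and adding it preserves order in \<open>ennreal\<close>
  even when it is infinite. Contraction thus becomes a comparison of finite real sums.\<close>

lemma l1_norm_mono_outside:
  assumes "finite W" and "\<And>u. u \<notin> W \<Longrightarrow> f u = g u"
    and "(\<Sum>u\<in>W. \<bar>f u\<bar>) \<le> (\<Sum>u\<in>W. \<bar>g u\<bar>)"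
  shows "l1_norm f \<le> l1_norm g"
proof -
  have "(\<Sum>\<^sub>\<infinity>u\<in>-W. ennreal \<bar>f u\<bar>) = (\<Sum>\<^sub>\<infinity>u\<in>-W. ennreal \<bar>g u\<bar>)"
    by (rule infsum_cong) (simp add: assms(2))
  moreover have "(\<Sum>u\<in>W. ennreal \<bar>f u\<bar>) \<le> (\<Sum>u\<in>W. ennreal \<bar>g u\<bar>)"
    using assms(3) by (simp add: sum_ennreal ennreal_leI)
  ultimately show ?thesis
    by (simp add: l1_norm_split[OF assms(1)] add_right_mono)
qed

lemma l1_norm_finite_support:
  assumes "finite W" and "\<And>u. u \<notin> W \<Longrightarrow> f u = 0"
  shows "l1_norm f = ennreal (\<Sum>u\<in>W. \<bar>f u\<bar>)"
proof -
  have "(\<Sum>\<^sub>\<infinity>u\<in>-W. ennreal \<bar>f u\<bar>) = 0"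
    by (rule infsum_0) (simp add: assms(2))
  then show ?thesis
    by (simp add: l1_norm_split[OF assms(1)] sum_ennreal)
qed

text \<open>A strict inequality at one index would make the sums strictly ordered. This serves to
  show that two caps spending the same mass act identically on each item.\<close>

lemma sum_mono_eqD:
  fixes f g :: "'a \<Rightarrow> real"
  assumes "finite W" and "\<And>u. u \<in> W \<Longrightarrow> f u \<le> g u" and "sum g W \<le> sum f W" and "u \<in> W"
  shows "f u = g u"
  using sum_strict_mono_ex1[of W f g] assms by force

text \<open>Intermediate value theorem between level 0, which spends nothing, and level
  \<open>sum G W\<close>, which caps no entry because nonnegative entries are at most their
  sum.\<close>

lemma ex_level:
  fixes G :: "'a \<Rightarrow> real"
  assumes "finite W" and "\<And>u. u \<in> W \<Longrightarrow> 0 \<le> G u" and "0 \<le> c" and "c \<le> sum G W"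
  shows "\<exists>l\<ge>0. (\<Sum>u\<in>W. min (G u) l) = c"
proof -
  have "(\<Sum>u\<in>W. min (G u) (sum G W)) = sum G W"
    by (intro sum.cong refl min_absorb1 member_le_sum) (use assms in auto)
  moreover have "(\<Sum>u\<in>W. min (G u) 0) = 0"
    by (intro sum.neutral ballI min_absorb2) (use assms in auto)
  moreover have "continuous_on {0..sum G W} (\<lambda>l. \<Sum>u\<in>W. min (G u) l)"
    by (intro continuous_intros)
  ultimately show ?thesis
    using IVT'[of "\<lambda>l. \<Sum>u\<in>W. min (G u) l" 0 c "sum G W"] assms by force
qed

text \<open>Hides the choice operator: later arguments use only that some level spends exactly
  1.\<close>

lemma l1_descent_cases:
  assumes "l1_descent \<Gamma> H W = Some H'"
  obtains (saturated) "(\<Sum>u\<in>W. \<bar>\<Gamma> - H u\<bar>) \<le> 1" "\<And>u. u \<in> W \<Longrightarrow> H' u = \<Gamma>"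
      "\<And>u. u \<notin> W \<Longrightarrow> H' u = H u"
  | (level) l where "(\<Sum>u\<in>W. min (\<Gamma> - H u) l) = 1"
      "\<And>u. u \<in> W \<Longrightarrow> H' u = H u + min (\<Gamma> - H u) l" "\<And>u. u \<notin> W \<Longrightarrow> H' u = H u"
proof (cases "(\<Sum>u\<in>W. \<bar>\<Gamma> - H u\<bar>) \<le> 1")
  case True
  then show ?thesis
    using assms saturated by (auto simp: l1_descent_def)
next
  case False
  define good where "good = (\<lambda>l. l \<ge> 0 \<and> (\<Sum>u\<in>W. min (\<Gamma> - H u) l) = 1)"
  have eq: "l1_descent \<Gamma> H W =
      (if \<exists>l. good l
       then Some (\<lambda>u. if u \<in> W then H u + min (\<Gamma> - H u) (SOME l. good l) else H u) else None)"
    using False unfolding l1_descent_def good_def Let_def by simp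
  with assms have ex: "\<exists>l. good l"
    by (metis option.distinct(1))
  then have "good (SOME l. good l)"
    by (rule someI_ex)
  then have "(\<Sum>u\<in>W. min (\<Gamma> - H u) (SOME l. good l)) = 1"
    unfolding good_def by simp
  moreover have "H' = (\<lambda>u. if u \<in> W then H u + min (\<Gamma> - H u) (SOME l. good l) else H u)"
    using assms eq ex by simp
  ultimately show ?thesis
    using level[of "SOME l. good l"] by simp
qed

lemma l1_descent_dominating_pairs:
  assumes W: "finite W" and pair: "(H1, H2) \<in> dominating_pairs"
    and 1: "l1_descent \<Gamma> H1 W = Some H1'" and 2: "l1_descent \<Gamma> H2 W = Some H2'"
  shows "(H1', H2') \<in> dominating_pairs"
proof -
  have le: "H2 u \<le> H1 u" for u
    using pair by (auto simp: dominating_pairs_def le_fun_def)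
  have norm: "l1_norm (\<lambda>u. H1 u - H2 u) \<le> 1"
    using pair by (auto simp: dominating_pairs_def)
  have out: "H1' u = H1 u" "H2' u = H2 u" if "u \<notin> W" for u
    using that by (auto intro: l1_descent_cases[OF 1] l1_descent_cases[OF 2])
  have nonneg: "0 \<le> (\<Sum>u\<in>W. H1 u - H2 u)"
    by (simp add: le sum_nonneg)
  have "(\<forall>u\<in>W. H2' u \<le> H1' u) \<and> (\<Sum>u\<in>W. H1' u - H2' u) \<le> (\<Sum>u\<in>W. H1 u - H2 u)"
  using 1
  proof (cases rule: l1_descent_cases)
    case s1: saturated
    show ?thesis
    using 2
    proof (cases rule: l1_descent_cases)
      case saturated
      then show ?thesis
        using s1 nonneg by simp
    next
      case (level l)
      \<comment> \<open>Saturation adds at most 1 to \<open>H1\<close> on \<open>W\<close>, while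
        \<open>H2\<close> receives exactly 1.\<close>
      have "(\<Sum>u\<in>W. \<Gamma> - H1 u) \<le> (\<Sum>u\<in>W. \<bar>\<Gamma> - H1 u\<bar>)"
        by (rule sum_mono) simp
      also have "\<dots> \<le> (\<Sum>u\<in>W. min (\<Gamma> - H2 u) l)"
        using s1 level by simp
      finally have "(\<Sum>u\<in>W. H1' u - H2' u) \<le> (\<Sum>u\<in>W. H1 u - H2 u)"
        using s1 level by (simp add: sum_subtractf sum.distrib)
      moreover have "H2' u \<le> H1' u" if "u \<in> W" for u
        using that s1 level by (simp add: min_def)
      ultimately show ?thesis
        by blast
    qed
  next
    case l1: (level l1)
    show ?thesis
    using 2
    proof (cases rule: l1_descent_cases)
      case saturated
      \<comment> \<open>By domination the gaps of \<open>H1\<close> sum to at most 1, yet capped at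
        \<open>l1\<close> they still sum to 1. So the cap is inactive and \<open>H1'\<close> also
        equals \<open>\<Gamma>\<close> on \<open>W\<close>.\<close>
      have "(\<Sum>u\<in>W. \<Gamma> - H1 u) \<le> (\<Sum>u\<in>W. \<bar>\<Gamma> - H2 u\<bar>)"
        by (rule sum_mono) (use le in \<open>smt (verit)\<close>)
      also have "\<dots> \<le> (\<Sum>u\<in>W. min (\<Gamma> - H1 u) l1)"
        using l1 saturated by simp
      finally have "min (\<Gamma> - H1 u) l1 = \<Gamma> - H1 u" if "u \<in> W" for u
        using that by (intro sum_mono_eqD[OF W]) auto
      then show ?thesis
        using l1 saturated nonneg by simp
    next
      case l2: (level l2)
      have "H2' u \<le> H1' u" if "u \<in> W" for u
      proof (cases "l2 \<le> l1")
        case True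
        then show ?thesis
          using l1(2)[OF that] l2(2)[OF that] le[of u] by (simp add: min_def)
      next
        case False
        \<comment> \<open>Levels are not unique, so \<open>l1 < l2\<close> is possible, but only if nothing changes for \<open>H2\<close>
          between the two.\<close>
        have "(\<Sum>u\<in>W. min (\<Gamma> - H2 u) l2) = (\<Sum>u\<in>W. min (\<Gamma> - H1 u) l1)"
          using l1 l2 by simp
        also have "\<dots> \<le> (\<Sum>u\<in>W. min (\<Gamma> - H2 u) l1)"
          by (intro sum_mono min.mono) (auto simp: le)
        finally have "min (\<Gamma> - H2 u) l1 = min (\<Gamma> - H2 u) l2"
          using that False by (intro sum_mono_eqD[OF W]) auto
        then show ?thesis
          using l1(2)[OF that] l2(2)[OF that] le[of u] by (simp add: min_def split: if_splits)
      qed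
      \<comment> \<open>Both updates add exactly 1 on \<open>W\<close>, so the sum of differences is
        unchanged.\<close>
      then show ?thesis
        using l1 l2 by (simp add: sum_subtractf sum.distrib)
    qed
  qed
  then have "\<forall>u\<in>W. H2' u \<le> H1' u"
      and sum': "(\<Sum>u\<in>W. H1' u - H2' u) \<le> (\<Sum>u\<in>W. H1 u - H2 u)"
    by blast+
  then have le': "H2' u \<le> H1' u" for u
    using out le by (cases "u \<in> W") simp_all
  \<comment> \<open>Domination before and after the update removes the absolute values, so the bound
    on signed sums bounds the norms.\<close>
  have "l1_norm (\<lambda>u. H1' u - H2' u) \<le> l1_norm (\<lambda>u. H1 u - H2 u)"
    by (rule l1_norm_mono_outside[OF W]) (use out sum' in \<open>simp_all add: le le'\<close>)
  then show ?thesis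
    using norm le' by (auto simp: dominating_pairs_def le_fun_def)
qed

text \<open>Below the cutoff all gaps on \<open>W\<close> are nonnegative: a level exists whenever
  they sum to more than 1, and the update only raises \<open>H\<close>, by at most 1 in
  total.\<close>

lemma l1_descent_below_cutoff:
  assumes W: "finite W" and below: "(H, W) \<in> below_cutoff \<Gamma>"
  shows "\<exists>H'. l1_descent \<Gamma> H W = Some H' \<and> (H', H) \<in> dominating_pairs"
proof -
  have nonneg: "0 \<le> \<Gamma> - H u" if "u \<in> W" for u
    using below that by (auto simp: below_cutoff_def)
  have "\<exists>l\<ge>0. (\<Sum>u\<in>W. min (\<Gamma> - H u) l) = 1" if "\<not> (\<Sum>u\<in>W. \<bar>\<Gamma> - H u\<bar>) \<le> 1"
    by (rule ex_level[OF W]) (use that nonneg in auto)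
  then obtain H' where H': "l1_descent \<Gamma> H W = Some H'"
    by (cases "(\<Sum>u\<in>W. \<bar>\<Gamma> - H u\<bar>) \<le> 1") (simp_all add: l1_descent_def)
  have "(\<forall>u. H u \<le> H' u) \<and> (\<forall>u. u \<notin> W \<longrightarrow> H' u = H u) \<and> (\<Sum>u\<in>W. H' u - H u) \<le> 1"
  using H'
  proof (cases rule: l1_descent_cases)
    case saturated
    then show ?thesis
      using nonneg by (smt (verit) sum.cong)
  next
    case (level l)
    \<comment> \<open>A negative level would make the spent mass nonpositive instead of 1.\<close>
    have "0 \<le> l"
    proof (rule ccontr)
      assume "\<not> 0 \<le> l"
      then have "(\<Sum>u\<in>W. min (\<Gamma> - H u) l) \<le> 0"
        by (intro sum_nonpos) auto
      then show False
        using level by simp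
    qed
    then have "H u \<le> H' u" for u
      using level nonneg by (cases "u \<in> W") auto
    then show ?thesis
      using level by simp
  qed
  then have le: "\<And>u. H u \<le> H' u" and out: "\<And>u. u \<notin> W \<Longrightarrow> H' u = H u"
      and sum: "(\<Sum>u\<in>W. H' u - H u) \<le> 1"
    by auto
  have "l1_norm (\<lambda>u. H' u - H u) = ennreal (\<Sum>u\<in>W. H' u - H u)"
    using l1_norm_finite_support[OF W, of "\<lambda>u. H' u - H u"] by (simp add: out le)
  then show ?thesis
    using H' le sum by (auto simp: dominating_pairs_def le_fun_def)
qed

theorem lemma4p1:
  fixes \<Gamma> :: real and \<Delta>0 :: nat
  assumes "\<Delta>0 \<ge> 1"
  shows "l1_contractive_over \<Delta>0 (below_cutoff \<Gamma>) (l1_descent \<Gamma>)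
           (dominating_pairs :: ('u hist \<times> 'u hist) set)"
  unfolding l1_contractive_over_def
proof (intro conjI allI impI)
  show "\<forall>(G1, G2) \<in> (dominating_pairs :: ('u hist \<times> 'u hist) set). l1_norm (\<lambda>u. G1 u - G2 u) \<le> 1"
    by (auto simp: dominating_pairs_def)
qed (use l1_descent_dominating_pairs l1_descent_below_cutoff in blast)+

end
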